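(* Let $P\in\mathrm{Gr}(\mathcal{K},\Gamma)$ be a projection operator such that $P-P_{0}$ is of Hilbert--Schmidt class. Then the associated Pfaffian point process $M^{P}$ is supported in $\Omega^{\circ}$, i.e. $M^{P}(\Omega^{\circ})=1$. Equivalently, a point process $X$ in $\mathfrak{X}$ obeying $M^{P}$ satisfies $\#X<\infty$ almost surely.
   Context: $\mathfrak{X}$ is a countable set, $\Omega=\{0,1\}^{\mathfrak{X}}$ carries the product topology and its Borel $\sigma$-algebra $\Sigma$; $\omega\in\Omega$ is identified with the subset $\{x:\omega(x)=1\}$ of $\mathfrak{X}$. $\Omega^{\circ}=\{\omega\in\Omega:\#\omega<\infty\}$. $e_{x}\in\ell^{2}(\mathfrak{X})$ is $e_{x}(y)=\delta_{x,y}$; inner products are linear in the second argument; $J$ is the antilinear complex conjugation on $\ell^{2}(\mathfrak{X})$ fixing each $e_{x}$; $\mathcal{K}=\ell^{2}(\mathfrak{X})\oplus\ell^{2}(\mathfrak{X})$ and $\Gamma=\begin{pmatrix}0 & J\\ J & 0\end{pmatrix}$; $\overline{A}:=\Gamma A\Gamma$. $\mathcal{Q}(\mathcal{K},\Gamma)=\{S\text{ bounded on }\mathcal{K}:0\le S=S^{\ast}\le 1,\ \overline{S}=1-S\}$ and $\mathrm{Gr}(\mathcal{K},\Gamma)=\{P\in\mathcal{Q}(\mathcal{K},\Gamma):P^{2}=P\}$. $P_{0}=\begin{pmatrix}I&0\\0&0\end{pmatrix}$ is the projection onto the first component of $\mathcal{K}$. For $S=\begin{pmatrix}S_{11}&S_{12}\\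 S_{21}&S_{22}\end{pmatrix}\in\mathcal{Q}(\mathcal{K},\Gamma)$, put $\mathbb{K}_{S}(x,y)=\begin{pmatrix}(e_{x},S_{21}e_{y}) & (e_{x},S_{22}e_{y})\\ (e_{x},(S_{11}-1)e_{y}) & (e_{x},S_{12}e_{y})\end{pmatrix}$, which satisfies $\mathbb{K}_{S}(x,y)^{\mathrm{T}}=-\mathbb{K}_{S}(y,x)$. $M^{S}$ denotes the unique probability measure on $(\Omega,\Sigma)$ (it exists) with $M^{S}(\{\omega:\omega(x_{1})=\cdots=\omega(x_{n})=1\})=\mathrm{Pf}[\mathbb{K}_{S}(x_{i},x_{j})]_{1\le i,j\le n}$ for all $n$ and distinct $x_{1},\dots,x_{n}\in\mathfrak{X}$, where $[\mathbb{K}_{S}(x_{i},x_{j})]$ is the antisymmetric $2n\times2n$ matrix with $2\times 2$ blocks $\mathbb{K}_{S}(x_{i},x_{j})$; it is the Pfaffian point process associated with $S$. A point process obeying $M$ is a random variable with values in $\Omega$ and law $M$. *)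

theory Defs
  imports "HOL-Probability.Probability" "HOL-Combinatorics.Permutations"
begin

section \<open>Complex inner product spaces\<close>

text \<open>The inner product is linear in the second argument.\<close>

class complex_inner = real_inner +
  fixes scaleC :: "complex \<Rightarrow> 'a \<Rightarrow> 'a"  (infixr \<open>*\<^sub>C\<close> 75)
    and cinner :: "'a \<Rightarrow> 'a \<Rightarrow> complex"
  assumes scaleC_add_right: "c *\<^sub>C (u + v) = c *\<^sub>C u + c *\<^sub>C v"
    and scaleC_add_left: "(c + d) *\<^sub>C u = c *\<^sub>C u + d *\<^sub>C u"
    and scaleC_scaleC: "c *\<^sub>C d *\<^sub>C u = (c * d) *\<^sub>C u"
    and scaleC_one: "1 *\<^sub>C u = u"
    and scaleC_of_real: "complex_of_real r *\<^sub>C u = r *\<^sub>R u"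
    and cinner_commute: "cinner u v = cnj (cinner v u)"
    and cinner_add_right: "cinner u (v + w) = cinner u v + cinner u w"
    and cinner_scaleC_right: "cinner u (c *\<^sub>C v) = c * cinner u v"
    and Re_cinner: "Re (cinner u v) = inner u v"

global_interpretation complex_vector: vector_space "scaleC :: complex \<Rightarrow> 'a \<Rightarrow> 'a::complex_inner"
  defines cspan = complex_vector.span
  by unfold_locales (auto simp: scaleC_add_right scaleC_add_left scaleC_scaleC scaleC_one)

instantiation prod :: (complex_inner, complex_inner) complex_inner
begin

definition scaleC_prod :: "complex \<Rightarrow> 'a \<times> 'b \<Rightarrow> 'a \<times> 'b"
  where "scaleC_prod c u = (c *\<^sub>C fst u, c *\<^sub>C snd u)"

definition cinner_prod :: "'a \<times> 'b \<Rightarrow> 'a \<times> 'b \<Rightarrow> complex"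
  where "cinner_prod u v = cinner (fst u) (fst v) + cinner (snd u) (snd v)"

instance
proof
  fix u v w :: "'a \<times> 'b" and c d :: complex and r :: real
  show "c *\<^sub>C (u + v) = c *\<^sub>C u + c *\<^sub>C v"
    and "(c + d) *\<^sub>C u = c *\<^sub>C u + d *\<^sub>C u"
    and "c *\<^sub>C d *\<^sub>C u = (c * d) *\<^sub>C u"
    and "1 *\<^sub>C u = u"
    and "complex_of_real r *\<^sub>C u = r *\<^sub>R u"
    by (simp_all add: scaleC_prod_def scaleC_add_right scaleC_add_left scaleC_scaleC
        scaleC_one scaleC_of_real prod_eq_iff)
  show "cinner u v = cnj (cinner v u)"
    unfolding cinner_prod_def
    by (subst (1 2) cinner_commute) simp
  show "cinner u (v + w) = cinner u v + cinner u w"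
    and "cinner u (c *\<^sub>C v) = c * cinner u v"
    by (simp_all add: cinner_prod_def scaleC_prod_def cinner_add_right cinner_scaleC_right
        algebra_simps)
  show "Re (cinner u v) = inner u v"
    by (simp add: cinner_prod_def inner_prod_def Re_cinner)
qed

end

definition bounded_clinear :: "('a::complex_inner \<Rightarrow> 'b::complex_inner) \<Rightarrow> bool"
  where "bounded_clinear A \<longleftrightarrow> bounded_linear A \<and> (\<forall>c u. A (c *\<^sub>C u) = c *\<^sub>C A u)"

text \<open>\<open>A = A\<^sup>*\<close>, for an everywhere defined bounded \<open>A\<close>.\<close>

definition selfadjoint :: "('a::complex_inner \<Rightarrow> 'a) \<Rightarrow> bool"
  where "selfadjoint A \<longleftrightarrow> (\<forall>u v. cinner (A u) v = cinner u (A v))"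

text \<open>The operator order: \<open>A \<le> B\<close> iff \<open>(u, (B - A) u)\<close> is a nonnegative real for all \<open>u\<close>.\<close>

definition op_le :: "('a::complex_inner \<Rightarrow> 'a) \<Rightarrow> ('a \<Rightarrow> 'a) \<Rightarrow> bool"
  where "op_le A B \<longleftrightarrow> (\<forall>u. cinner u (B u - A u) \<in> \<real>\<^sub>\<ge>\<^sub>0)"

definition orthonormal_basis :: "'a::complex_inner set \<Rightarrow> bool"
  where "orthonormal_basis B \<longleftrightarrow>
    (\<forall>b\<in>B. \<forall>c\<in>B. cinner b c = (if b = c then 1 else 0)) \<and> closure (cspan B) = UNIV"

text \<open>On a Hilbert space the sum does not depend on the choice of the orthonormal basis.\<close>

definition hilbert_schmidt :: "('a::complex_inner \<Rightarrow> 'b::complex_inner) \<Rightarrow> bool"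
  where "hilbert_schmidt A \<longleftrightarrow> bounded_clinear A \<and>
    (\<exists>B. orthonormal_basis B \<and> (\<lambda>b. (norm (A b))\<^sup>2) summable_on B)"

section \<open>Square-summable functions\<close>

definition square_summable :: "('a \<Rightarrow> complex) set"
  where "square_summable = {f. (\<lambda>x. (cmod (f x))\<^sup>2) summable_on UNIV}"

lemma square_summable_zero: "(\<lambda>_. 0) \<in> square_summable"
  by (simp add: square_summable_def)

lemma square_summable_scale:
  assumes "f \<in> square_summable" shows "(\<lambda>x. c * f x) \<in> square_summable"
  using assms
  by (simp add: square_summable_def norm_mult power_mult_distrib summable_on_cmult_right)

lemma square_summable_add:
  assumes "f \<in> square_summable" "g \<in> square_summable"
  shows "(\<lambda>x. f x + g x) \<in> square_summable"
proof -
  have *: "(\<lambda>x. 2 * (cmod (f x))\<^sup>2 + 2 * (cmod (g x))\<^sup>2) summable_on UNIV"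
    using assms unfolding square_summable_def
    by (auto intro!: summable_on_add summable_on_cmult_right)
  have "(cmod (f x + g x))\<^sup>2 \<le> 2 * (cmod (f x))\<^sup>2 + 2 * (cmod (g x))\<^sup>2" for x
  proof -
    have "(cmod (f x + g x))\<^sup>2 \<le> (cmod (f x) + cmod (g x))\<^sup>2"
      by (intro power_mono norm_triangle_ineq) simp
    also have "\<dots> \<le> 2 * (cmod (f x))\<^sup>2 + 2 * (cmod (g x))\<^sup>2"
      using zero_le_power2[of "cmod (f x) - cmod (g x)"]
      by (simp add: power2_eq_square algebra_simps)
    finally show ?thesis .
  qed
  then show ?thesis
    unfolding square_summable_def mem_Collect_eq
    by (intro summable_on_comparison_test[OF *]) auto
qed

lemma square_summable_mult:
  assumes "f \<in> square_summable" "g \<in> square_summable"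
  shows "(\<lambda>x. cnj (f x) * g x) summable_on UNIV"
proof (rule abs_summable_summable, rule summable_on_comparison_test)
  show "(\<lambda>x. (cmod (f x))\<^sup>2 + (cmod (g x))\<^sup>2) summable_on UNIV"
    using assms unfolding square_summable_def by (auto intro!: summable_on_add)
  show "cmod (cnj (f x) * g x) \<le> (cmod (f x))\<^sup>2 + (cmod (g x))\<^sup>2" for x
  proof -
    have "0 \<le> cmod (f x) * cmod (g x)"
      by simp
    moreover have "2 * (cmod (f x) * cmod (g x)) \<le> (cmod (f x))\<^sup>2 + (cmod (g x))\<^sup>2"
      using zero_le_power2[of "cmod (f x) - cmod (g x)"]
      by (simp add: power2_eq_square algebra_simps)
    ultimately have "cmod (f x) * cmod (g x) \<le> (cmod (f x))\<^sup>2 + (cmod (g x))\<^sup>2"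
      by linarith
    then show ?thesis
      by (simp add: norm_mult)
  qed
qed simp

typedef 'a ell2 = "square_summable :: ('a \<Rightarrow> complex) set"
  using square_summable_zero by blast

setup_lifting type_definition_ell2

instantiation ell2 :: (type) complex_inner
begin

lift_definition zero_ell2 :: "'a ell2" is "\<lambda>_. 0"
  by (rule square_summable_zero)

lift_definition plus_ell2 :: "'a ell2 \<Rightarrow> 'a ell2 \<Rightarrow> 'a ell2" is "\<lambda>f g x. f x + g x"
  by (rule square_summable_add)

lift_definition scaleC_ell2 :: "complex \<Rightarrow> 'a ell2 \<Rightarrow> 'a ell2" is "\<lambda>c f x. c * f x"
  by (rule square_summable_scale)

lift_definition uminus_ell2 :: "'a ell2 \<Rightarrow> 'a ell2" is "\<lambda>f x. - f x"
  by (simp add: square_summable_def)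

definition minus_ell2 :: "'a ell2 \<Rightarrow> 'a ell2 \<Rightarrow> 'a ell2"
  where "minus_ell2 f g = f + (- g)"

definition scaleR_ell2 :: "real \<Rightarrow> 'a ell2 \<Rightarrow> 'a ell2"
  where "scaleR_ell2 r f = complex_of_real r *\<^sub>C f"

lift_definition cinner_ell2 :: "'a ell2 \<Rightarrow> 'a ell2 \<Rightarrow> complex"
  is "\<lambda>f g. \<Sum>\<^sub>\<infinity>x. cnj (f x) * g x" .

definition inner_ell2 :: "'a ell2 \<Rightarrow> 'a ell2 \<Rightarrow> real"
  where "inner_ell2 f g = Re (cinner f g)"

definition norm_ell2 :: "'a ell2 \<Rightarrow> real"
  where "norm_ell2 f = sqrt (inner f f)"

definition sgn_ell2 :: "'a ell2 \<Rightarrow> 'a ell2"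
  where "sgn_ell2 f = inverse (norm f) *\<^sub>R f"

definition dist_ell2 :: "'a ell2 \<Rightarrow> 'a ell2 \<Rightarrow> real"
  where "dist_ell2 f g = norm (f - g)"

definition uniformity_ell2 :: "('a ell2 \<times> 'a ell2) filter"
  where "uniformity_ell2 = (INF e\<in>{0<..}. principal {(f, g). dist f g < e})"

definition open_ell2 :: "'a ell2 set \<Rightarrow> bool"
  where "open_ell2 U \<longleftrightarrow> (\<forall>f\<in>U. \<forall>\<^sub>F (f', g) in uniformity. f' = f \<longrightarrow> g \<in> U)"

instance
proof
  fix u v w :: "'a ell2" and c d :: complex and r s :: real and U :: "'a ell2 set"
  show "u + v + w = u + (v + w)" "u + v = v + u" "0 + u = u" "- u + u = 0"
    by (transfer; simp add: fun_eq_iff algebra_simps)+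
  show "u - v = u + - v"
    by (simp add: minus_ell2_def)
  show scaleC:
    "c *\<^sub>C (u + v) = c *\<^sub>C u + c *\<^sub>C v"
    "(c + d) *\<^sub>C u = c *\<^sub>C u + d *\<^sub>C u"
    "c *\<^sub>C d *\<^sub>C u = (c * d) *\<^sub>C u"
    "1 *\<^sub>C u = u"
    for c d and u v :: "'a ell2"
    by (transfer; simp add: fun_eq_iff algebra_simps)+
  show "complex_of_real r *\<^sub>C u = r *\<^sub>R u"
    by (simp add: scaleR_ell2_def)
  show "r *\<^sub>R (u + v) = r *\<^sub>R u + r *\<^sub>R v" "(r + s) *\<^sub>R u = r *\<^sub>R u + s *\<^sub>R u"
    "r *\<^sub>R s *\<^sub>R u = (r * s) *\<^sub>R u" "1 *\<^sub>R u = u"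
    by (simp_all add: scaleR_ell2_def scaleC)
  show comm: "cinner u v = cnj (cinner v u)" for u v :: "'a ell2"
    by transfer (simp add: mult.commute flip: infsum_cnj)
  show add: "cinner u (v + w) = cinner u v + cinner u w" for u v w :: "'a ell2"
    by transfer (simp add: distrib_left infsum_add square_summable_mult)
  show scale: "cinner u (c *\<^sub>C v) = c * cinner u v" for u v :: "'a ell2" and c
  proof transfer
    fix f g :: "'a \<Rightarrow> complex" and c
    show "(\<Sum>\<^sub>\<infinity>x. cnj (f x) * (c * g x)) = c * (\<Sum>\<^sub>\<infinity>x. cnj (f x) * g x)"
      by (subst infsum_cmult_right'[symmetric]) (simp add: mult_ac)
  qed
  show "Re (cinner u v) = inner u v"
    by (simp add: inner_ell2_def)
  show "inner u v = inner v u"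
    unfolding inner_ell2_def by (subst comm) simp
  show "inner (u + v) w = inner u w + inner v w"
    unfolding inner_ell2_def by (subst (1 2 3) comm) (simp add: add)
  show "inner (r *\<^sub>R u) v = r * inner u v"
    unfolding inner_ell2_def scaleR_ell2_def by (subst (1 2) comm) (simp add: scale)
  have sq: "inner u u = (\<Sum>\<^sub>\<infinity>x. (cmod (Rep_ell2 u x))\<^sup>2)"
  proof -
    have "(\<lambda>x. cnj (Rep_ell2 u x) * Rep_ell2 u x) summable_on UNIV"
      using Rep_ell2 by (intro square_summable_mult)
    then have "inner u u = (\<Sum>\<^sub>\<infinity>x. Re (cnj (Rep_ell2 u x) * Rep_ell2 u x))"
      unfolding inner_ell2_def cinner_ell2.rep_eq by (rule infsum_Re[symmetric])
    then show ?thesis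
      by (simp only: cmod_power2) (simp add: power2_eq_square)
  qed
  show "0 \<le> inner u u"
    unfolding sq by (intro infsum_nonneg) simp
  show "inner u u = 0 \<longleftrightarrow> u = 0"
  proof
    assume "inner u u = 0"
    moreover have "(\<lambda>x. (cmod (Rep_ell2 u x))\<^sup>2) summable_on UNIV"
      using Rep_ell2[of u] by (simp add: square_summable_def)
    ultimately have "Rep_ell2 u x = 0" for x
      using nonneg_infsum_le_0D[of "\<lambda>x. (cmod (Rep_ell2 u x))\<^sup>2" UNIV x] sq by simp
    then show "u = 0"
      by (simp add: Rep_ell2_inject[symmetric] zero_ell2.rep_eq fun_eq_iff)
  next
    assume "u = 0"
    then show "inner u u = 0"
      unfolding sq by (simp add: zero_ell2.rep_eq)
  qed
  show "norm u = sqrt (inner u u)" "sgn u = inverse (norm u) *\<^sub>R u" "dist u v = norm (u - v)"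
    by (simp_all add: norm_ell2_def sgn_ell2_def dist_ell2_def)
  show "uniformity = (INF e\<in>{0<..}. principal {(x, y). dist x (y::'a ell2) < e})"
    by (rule uniformity_ell2_def)
  show "open U \<longleftrightarrow> (\<forall>f\<in>U. \<forall>\<^sub>F (f', g) in uniformity. f' = f \<longrightarrow> g \<in> U)"
    by (rule open_ell2_def)
qed

end

text \<open>The standard basis vectors \<open>e\<^sub>x\<close>.\<close>

lift_definition ell2_basis :: "'a \<Rightarrow> 'a ell2" is "\<lambda>x y. if x = y then 1 else 0"
proof -
  fix x :: 'a
  have "(\<lambda>y. (cmod (if x = y then 1 else 0))\<^sup>2) summable_on {x}"
    by simp
  then show "(\<lambda>y. if x = y then 1 else 0) \<in> square_summable"
    unfolding square_summable_def mem_Collect_eq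
    by (subst summable_on_cong_neutral[where T = "{x}"]) auto
qed

text \<open>The antilinear complex conjugation \<open>J\<close>.\<close>

lift_definition ell2_cnj :: "'a ell2 \<Rightarrow> 'a ell2" is "\<lambda>f x. cnj (f x)"
  by (simp add: square_summable_def)

section \<open>The spaces \<open>\<Q>(\<K>, \<Gamma>)\<close> and \<open>Gr(\<K>, \<Gamma>)\<close>\<close>

type_synonym 'a doubled = "'a ell2 \<times> 'a ell2"

definition Gamma :: "'a doubled \<Rightarrow> 'a doubled"
  where "Gamma u = (ell2_cnj (snd u), ell2_cnj (fst u))"

definition op_bar :: "('a doubled \<Rightarrow> 'a doubled) \<Rightarrow> ('a doubled \<Rightarrow> 'a doubled)"
  where "op_bar A = Gamma \<circ> A \<circ> Gamma"

definition Q_ops :: "('a doubled \<Rightarrow> 'a doubled) set"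
  where "Q_ops = {S. bounded_clinear S \<and> selfadjoint S \<and> op_le (\<lambda>_. 0) S \<and> op_le S id \<and>
    op_bar S = (\<lambda>u. u - S u)}"

definition Gr :: "('a doubled \<Rightarrow> 'a doubled) set"
  where "Gr = {P \<in> Q_ops. P \<circ> P = P}"

definition P0 :: "'a doubled \<Rightarrow> 'a doubled"
  where "P0 u = (fst u, 0)"

section \<open>Pfaffian point processes\<close>

text \<open>The Pfaffian of the antisymmetric \<open>2n \<times> 2n\<close> matrix \<open>(A i j)\<close>, \<open>0 \<le> i, j < 2n\<close>.\<close>

definition pfaffian :: "nat \<Rightarrow> (nat \<Rightarrow> nat \<Rightarrow> complex) \<Rightarrow> complex"
  where "pfaffian n A = (1 / (2 ^ n * fact n)) *
    (\<Sum>\<sigma> | \<sigma> permutes {..<2 * n}. of_int (sign \<sigma>) * (\<Prod>i<n. A (\<sigma> (2 * i)) (\<sigma> (2 * i + 1))))"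

definition block11 :: "('a doubled \<Rightarrow> 'a doubled) \<Rightarrow> 'a ell2 \<Rightarrow> 'a ell2"
  where "block11 S f = fst (S (f, 0))"

definition block12 :: "('a doubled \<Rightarrow> 'a doubled) \<Rightarrow> 'a ell2 \<Rightarrow> 'a ell2"
  where "block12 S f = fst (S (0, f))"

definition block21 :: "('a doubled \<Rightarrow> 'a doubled) \<Rightarrow> 'a ell2 \<Rightarrow> 'a ell2"
  where "block21 S f = snd (S (f, 0))"

definition block22 :: "('a doubled \<Rightarrow> 'a doubled) \<Rightarrow> 'a ell2 \<Rightarrow> 'a ell2"
  where "block22 S f = snd (S (0, f))"

text \<open>The \<open>2 \<times> 2\<close> matrix \<open>\<bbbK>\<^sub>S(x, y)\<close>, as the list of its rows.\<close>

definition pf_kernel :: "('a doubled \<Rightarrow> 'a doubled) \<Rightarrow> 'a \<Rightarrow> 'a \<Rightarrow> complex list list"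
  where "pf_kernel S x y =
    [[cinner (ell2_basis x) (block21 S (ell2_basis y)),
      cinner (ell2_basis x) (block22 S (ell2_basis y))],
     [cinner (ell2_basis x) (block11 S (ell2_basis y) - ell2_basis y),
      cinner (ell2_basis x) (block12 S (ell2_basis y))]]"

text \<open>The block matrix with \<open>2 \<times> 2\<close> blocks \<open>\<bbbK>\<^sub>S(x\<^sub>i, x\<^sub>j)\<close>, with zero-based indices.\<close>

definition pf_matrix :: "('a doubled \<Rightarrow> 'a doubled) \<Rightarrow> 'a list \<Rightarrow> nat \<Rightarrow> nat \<Rightarrow> complex"
  where "pf_matrix S xs i j =
    pf_kernel S (xs ! (i div 2)) (xs ! (j div 2)) ! (i mod 2) ! (j mod 2)"

text \<open>Configurations in \<open>\<Omega> = {0, 1}\<^sup>\<XX>\<close> are predicates; \<open>borel\<close> on the function type is the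
  Borel \<open>\<sigma>\<close>-algebra of the product topology. \<open>pfaffian_process S M\<close> says that \<open>M\<close> is the
  (unique) probability measure \<open>M\<^sup>S\<close> on \<open>\<Omega>\<close>.\<close>

definition pfaffian_process ::
    "('a::countable doubled \<Rightarrow> 'a doubled) \<Rightarrow> ('a \<Rightarrow> bool) measure \<Rightarrow> bool"
  where "pfaffian_process S M \<longleftrightarrow> prob_space M \<and> sets M = sets borel \<and>
    (\<forall>xs. distinct xs \<longrightarrow>
      complex_of_real (measure M {\<omega>. \<forall>x\<in>set xs. \<omega> x}) = pfaffian (length xs) (pf_matrix S xs))"

definition finite_configs :: "('a \<Rightarrow> bool) set"
  where "finite_configs = {\<omega>. finite {x. \<omega> x}}"

text \<open>\<open>X\<close> is a random variable on the probability space \<open>N\<close>, with values in \<open>\<Omega>\<close> and law \<open>M\<close>.\<close>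

definition obeys :: "'b measure \<Rightarrow> ('b \<Rightarrow> 'a \<Rightarrow> bool) \<Rightarrow> ('a::countable \<Rightarrow> bool) measure \<Rightarrow> bool"
  where "obeys N X M \<longleftrightarrow> prob_space N \<and> X \<in> N \<rightarrow>\<^sub>M borel \<and> distr N borel X = M"

end

theory Submission
  imports Defs
begin

text \<open>
  The expected number of points is finite, so the number of points is almost surely finite.

  The probability that \<open>x\<close> is occupied is the Pfaffian of the single block \<open>\<bbbK>\<^sub>P(x, x)\<close>, that is
  half the sum of \<open>(e\<^sub>x, P\<^sub>2\<^sub>2 e\<^sub>x)\<close> and \<open>(e\<^sub>x, (1 - P\<^sub>1\<^sub>1) e\<^sub>x)\<close>. Since \<open>P\<close> and \<open>1 - P\<close> are
  orthogonal projections, these two numbers are the squared norms of \<open>P (0, e\<^sub>x)\<close> and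
  \<open>(1 - P) (e\<^sub>x, 0)\<close>. The projection \<open>P\<^sub>0\<close> annihilates \<open>(0, e\<^sub>x)\<close> and fixes \<open>(e\<^sub>x, 0)\<close>, so both are
  squared norms of values of \<open>P - P\<^sub>0\<close>: the occupation probability of \<open>x\<close> is half of
  \<open>\<parallel>(P - P\<^sub>0) (e\<^sub>x, 0)\<parallel>\<^sup>2 + \<parallel>(P - P\<^sub>0) (0, e\<^sub>x)\<parallel>\<^sup>2\<close> (\<open>pfaffian_one_point\<close>). The vectors \<open>(e\<^sub>x, 0)\<close>
  and \<open>(0, e\<^sub>x)\<close> together form an orthonormal family, so the occupation probabilities add up to
  at most half of the squared Hilbert--Schmidt norm of \<open>P - P\<^sub>0\<close>. The Borel--Cantelli lemma
  then shows that almost surely only finitely many points are occupied (\<open>AE_finite_config\<close>).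

  The Hilbert--Schmidt condition only provides some orthonormal basis along which the squared
  norms are summable. Passing to the vectors \<open>(e\<^sub>x, 0)\<close> and \<open>(0, e\<^sub>x)\<close> is the independence of the
  Hilbert--Schmidt norm of the basis (\<open>selfadjoint_hilbert_schmidt_summable\<close>); it rests on
  Parseval's identity for the given basis and Bessel's inequality for the given family.
\<close>

section \<open>Orthonormal families in complex inner product spaces\<close>

lemma cinner_add_left: "cinner (u + v) w = cinner u w + cinner v w"
  by (metis cinner_commute cinner_add_right complex_cnj_add)

lemma cinner_scaleC_left: "cinner (c *\<^sub>C u) v = cnj c * cinner u v"
  by (metis cinner_commute cinner_scaleC_right complex_cnj_mult)

lemma cinner_zero_right [simp]: "cinner u 0 = 0"
  using cinner_add_right[of u 0 0] by simp

lemma cinner_zero_left [simp]: "cinner 0 u = 0"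
  by (subst cinner_commute) simp

lemma cinner_diff_right: "cinner u (v - w) = cinner u v - cinner u w"
  using cinner_add_right[of u "v - w" w] by simp

lemma cinner_diff_left: "cinner (u - v) w = cinner u w - cinner v w"
  using cinner_add_left[of "u - v" v w] by simp

lemma cinner_sum_right: "cinner u (\<Sum>i\<in>T. f i) = (\<Sum>i\<in>T. cinner u (f i))"
  by (induction T rule: infinite_finite_induct) (simp_all add: cinner_add_right)

lemma cinner_sum_left: "cinner (\<Sum>i\<in>T. f i) u = (\<Sum>i\<in>T. cinner (f i) u)"
  by (induction T rule: infinite_finite_induct) (simp_all add: cinner_add_left)

lemma cinner_self: "cinner u u = complex_of_real ((norm u)\<^sup>2)"
proof -
  have "Im (cinner u u) = - Im (cinner u u)"
    by (subst cinner_commute) simp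
  then show ?thesis
    by (simp add: complex_eq_iff Re_cinner power2_norm_eq_inner)
qed

lemma cmod_cinner_commute: "cmod (cinner u v) = cmod (cinner v u)"
  by (metis cinner_commute complex_mod_cnj)

definition orthonormal_on :: "'i set \<Rightarrow> ('i \<Rightarrow> 'a::complex_inner) \<Rightarrow> bool"
  where "orthonormal_on I f \<longleftrightarrow> (\<forall>i\<in>I. \<forall>j\<in>I. cinner (f i) (f j) = (if i = j then 1 else 0))"

lemma orthonormal_on_subset: "orthonormal_on I f \<Longrightarrow> T \<subseteq> I \<Longrightarrow> orthonormal_on T f"
  unfolding orthonormal_on_def by blast

lemma orthonormal_basis_imp_orthonormal_on: "orthonormal_basis B \<Longrightarrow> orthonormal_on B (\<lambda>b. b)"
  by (simp add: orthonormal_on_def orthonormal_basis_def)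

text \<open>Completing the square in the coefficients. With the Fourier coefficients
  \<open>c i = (f i, u)\<close> this gives Bessel's inequality; with arbitrary \<open>c\<close> it says that no other
  combination approximates \<open>u\<close> better, which turns density of the span into Parseval's
  identity.\<close>

lemma norm_diff_orthonormal_combination:
  assumes "finite T" "orthonormal_on T f"
  shows "(norm (u - (\<Sum>i\<in>T. c i *\<^sub>C f i)))\<^sup>2 =
    (norm u)\<^sup>2 - (\<Sum>i\<in>T. (cmod (cinner (f i) u))\<^sup>2) + (\<Sum>i\<in>T. (cmod (c i - cinner (f i) u))\<^sup>2)"
proof -
  let ?p = "\<Sum>i\<in>T. c i *\<^sub>C f i" and ?a = "\<lambda>i. cinner (f i) u"
  have pu: "cinner ?p u = (\<Sum>i\<in>T. cnj (c i) * ?a i)"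
    by (simp add: cinner_sum_left cinner_scaleC_left)
  have "cinner (f i) ?p = c i" if i: "i \<in> T" for i
  proof -
    have "cinner (f i) ?p = (\<Sum>j\<in>T. if i = j then c j else 0)"
      unfolding cinner_sum_right cinner_scaleC_right
      using assms(2) i by (intro sum.cong) (simp_all add: orthonormal_on_def)
    then show ?thesis
      using assms(1) i by simp
  qed
  then have pp: "cinner ?p ?p = (\<Sum>i\<in>T. cnj (c i) * c i)"
    by (simp add: cinner_sum_left cinner_scaleC_left)
  have "(norm (u - ?p))\<^sup>2 = (norm u)\<^sup>2 - 2 * Re (cinner ?p u) + Re (cinner ?p ?p)"
    by (simp add: Re_cinner power2_norm_eq_inner inner_diff_left inner_diff_right inner_commute)
  also have "\<dots> = (norm u)\<^sup>2 + (\<Sum>i\<in>T. Re (cnj (c i) * c i) - 2 * Re (cnj (c i) * ?a i))"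
    by (simp add: pu pp sum_subtractf sum_distrib_left)
  also have "(\<Sum>i\<in>T. Re (cnj (c i) * c i) - 2 * Re (cnj (c i) * ?a i)) =
      (\<Sum>i\<in>T. (cmod (c i - ?a i))\<^sup>2 - (cmod (?a i))\<^sup>2)"
    unfolding cmod_power2 by (rule sum.cong) (simp_all add: power2_eq_square algebra_simps)
  finally show ?thesis
    by (simp add: sum_subtractf)
qed

lemma bessel:
  assumes "finite T" "orthonormal_on T f"
  shows "(\<Sum>i\<in>T. (cmod (cinner (f i) u))\<^sup>2) \<le> (norm u)\<^sup>2"
  using norm_diff_orthonormal_combination[OF assms, of u "\<lambda>i. cinner (f i) u"]
    zero_le_power2[of "norm (u - (\<Sum>i\<in>T. cinner (f i) u *\<^sub>C f i))"]
  by simp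

lemma orthonormal_basis_partial_parseval:
  assumes "orthonormal_basis B" "0 < e"
  obtains T where "finite T" "T \<subseteq> B" "(norm u)\<^sup>2 - e < (\<Sum>b\<in>T. (cmod (cinner b u))\<^sup>2)"
proof -
  have "u \<in> closure (cspan B)"
    using assms by (simp add: orthonormal_basis_def)
  then obtain v where v: "v \<in> cspan B" "norm (v - u) < sqrt e"
    unfolding closure_approachable dist_norm using assms(2) real_sqrt_gt_zero by blast
  obtain T c where T: "finite T" "T \<subseteq> B" "v = (\<Sum>b\<in>T. c b *\<^sub>C b)"
    using v(1) unfolding complex_vector.span_explicit by blast
  have "orthonormal_on T (\<lambda>b. b)"
    using assms(1) T(2) orthonormal_basis_imp_orthonormal_on orthonormal_on_subset by blast
  then have "(norm u)\<^sup>2 - (\<Sum>b\<in>T. (cmod (cinner b u))\<^sup>2) \<le> (norm (u - v))\<^sup>2"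
    unfolding T(3) by (subst norm_diff_orthonormal_combination[OF T(1)]) (simp_all add: sum_nonneg)
  also have "\<dots> < e"
  proof -
    have "(norm (u - v))\<^sup>2 < (sqrt e)\<^sup>2"
      using v(2) by (intro power_strict_mono) (simp_all add: norm_minus_commute)
    then show ?thesis
      using assms(2) by simp
  qed
  finally show ?thesis
    using that T by fastforce
qed

lemma parseval:
  assumes "orthonormal_basis B"
  shows "((\<lambda>b. (cmod (cinner b u))\<^sup>2) has_sum (norm u)\<^sup>2) B"
proof -
  let ?g = "\<lambda>b. (cmod (cinner b u))\<^sup>2"
  have le: "sum ?g T \<le> (norm u)\<^sup>2" if "finite T" "T \<subseteq> B" for T
  proof (rule bessel[OF that(1)])
    show "orthonormal_on T (\<lambda>b. b)"
      using orthonormal_basis_imp_orthonormal_on[OF assms] that(2) by (rule orthonormal_on_subset)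
  qed
  then have sm: "?g summable_on B"
    by (intro nonneg_bdd_above_summable_on bdd_aboveI2) auto
  have "infsum ?g B \<le> (norm u)\<^sup>2"
    using sm le by (rule infsum_le_finite_sums)
  moreover have "(norm u)\<^sup>2 \<le> infsum ?g B + e" if e: "e > 0" for e
  proof -
    obtain T where T: "finite T" "T \<subseteq> B" "(norm u)\<^sup>2 - e < sum ?g T"
      using orthonormal_basis_partial_parseval[OF assms e] .
    show ?thesis
      using finite_sum_le_infsum[OF sm T(1,2)] T(3) by simp
  qed
  then have "(norm u)\<^sup>2 \<le> infsum ?g B"
    by (rule field_le_epsilon)
  ultimately show ?thesis
    using sm has_sum_infsum by fastforce
qed

text \<open>Expand each \<open>A (f i)\<close> in a basis \<open>B\<close> for which the Hilbert--Schmidt sum is finite, and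
  exchange the sums over \<open>i\<close> and over \<open>B\<close>. As \<open>|(b, A (f i))| = |(f i, A b)|\<close>, Bessel's
  inequality bounds the inner sum over \<open>i\<close> by \<open>\<parallel>A b\<parallel>\<^sup>2\<close>.\<close>

lemma selfadjoint_hilbert_schmidt_summable:
  assumes "hilbert_schmidt A" "selfadjoint A" "orthonormal_on I f"
  shows "(\<lambda>i. (norm (A (f i)))\<^sup>2) summable_on I"
proof -
  obtain B where B: "orthonormal_basis B" "(\<lambda>b. (norm (A b))\<^sup>2) summable_on B"
    using assms(1) by (auto simp: hilbert_schmidt_def)
  have "(\<Sum>i\<in>F. (norm (A (f i)))\<^sup>2) \<le> (\<Sum>\<^sub>\<infinity>b\<in>B. (norm (A b))\<^sup>2)" if F: "finite F" "F \<subseteq> I" for F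
  proof (rule has_sum_mono)
    show "((\<lambda>b. \<Sum>i\<in>F. (cmod (cinner b (A (f i))))\<^sup>2) has_sum (\<Sum>i\<in>F. (norm (A (f i)))\<^sup>2)) B"
      using F(1) by induction (auto intro!: has_sum_add parseval B(1))
    show "((\<lambda>b. (norm (A b))\<^sup>2) has_sum (\<Sum>\<^sub>\<infinity>b\<in>B. (norm (A b))\<^sup>2)) B"
      using B(2) by (rule has_sum_infsum)
    show "(\<Sum>i\<in>F. (cmod (cinner b (A (f i))))\<^sup>2) \<le> (norm (A b))\<^sup>2" for b
    proof -
      have "orthonormal_on F f"
        using assms(3) F(2) by (rule orthonormal_on_subset)
      moreover have "cmod (cinner b (A (f i))) = cmod (cinner (f i) (A b))" for i
        using assms(2) by (metis selfadjoint_def cmod_cinner_commute)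
      ultimately show ?thesis
        using bessel[OF F(1), of f "A b"] by simp
    qed
  qed
  then show ?thesis
    by (intro nonneg_bdd_above_summable_on bdd_aboveI2) auto
qed

section \<open>The one-point function of the process\<close>

lemma pfaffian_1: "pfaffian 1 A = (A 0 1 - A 1 0) / 2"
proof -
  have two: "{..<2 * 1} = {0, 1::nat}"
    by auto
  have perms: "{\<sigma>. \<sigma> permutes {..<2 * (1::nat)}} = {id, Transposition.transpose 0 1}"
    unfolding two permutes_doubleton_iff by blast
  have "id \<noteq> Transposition.transpose (0::nat) 1"
    by (metis id_apply transpose_apply_first zero_neq_one)
  then show ?thesis
    unfolding pfaffian_def perms by (simp add: sign_swap_id)
qed

lemma projection_cinner:
  assumes "selfadjoint P" "P \<circ> P = P"
  shows "cinner u (P u) = complex_of_real ((norm (P u))\<^sup>2)"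
    and "cinner u (u - P u) = complex_of_real ((norm (u - P u))\<^sup>2)"
proof -
  have P: "cinner (P u) (P u) = cinner u (P u)"
    using assms by (simp add: selfadjoint_def fun_eq_iff)
  moreover have "cinner (P u) u = cinner u (P u)"
    using assms(1) by (simp add: selfadjoint_def)
  ultimately have "cinner (u - P u) (u - P u) = cinner u (u - P u)"
    by (simp add: cinner_diff_left cinner_diff_right)
  with P show "cinner u (P u) = complex_of_real ((norm (P u))\<^sup>2)"
    "cinner u (u - P u) = complex_of_real ((norm (u - P u))\<^sup>2)"
    by (simp_all add: cinner_self)
qed

text \<open>The entry \<open>(e\<^sub>x, P\<^sub>2\<^sub>2 e\<^sub>x)\<close> is \<open>\<parallel>P (0, e\<^sub>x)\<parallel>\<^sup>2\<close>, where \<open>P\<^sub>0 (0, e\<^sub>x) = 0\<close>; the negative of the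
  entry \<open>(e\<^sub>x, (P\<^sub>1\<^sub>1 - 1) e\<^sub>x)\<close> is \<open>\<parallel>(1 - P) (e\<^sub>x, 0)\<parallel>\<^sup>2\<close>, where \<open>P\<^sub>0 (e\<^sub>x, 0) = (e\<^sub>x, 0)\<close>.\<close>

lemma pfaffian_one_point:
  assumes "selfadjoint P" "P \<circ> P = P"
  shows "pfaffian 1 (pf_matrix P [x]) = complex_of_real
    (((norm (P (ell2_basis x, 0) - P0 (ell2_basis x, 0)))\<^sup>2 +
      (norm (P (0, ell2_basis x) - P0 (0, ell2_basis x)))\<^sup>2) / 2)"
proof -
  let ?e = "ell2_basis x :: 'a ell2"
  have "pf_matrix P [x] 0 1 = cinner (0, ?e) (P (0, ?e))"
    by (simp add: pf_matrix_def pf_kernel_def block22_def cinner_prod_def)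
  also have "\<dots> = complex_of_real ((norm (P (0, ?e) - P0 (0, ?e)))\<^sup>2)"
    using projection_cinner(1)[OF assms, of "(0, ?e)"] by (simp add: P0_def flip: zero_prod_def)
  finally have m01: "pf_matrix P [x] 0 1 = \<dots>" .
  have "- pf_matrix P [x] 1 0 = cinner (?e, 0) ((?e, 0) - P (?e, 0))"
    by (simp add: pf_matrix_def pf_kernel_def block11_def cinner_prod_def cinner_diff_right)
  also have "\<dots> = complex_of_real ((norm (P (?e, 0) - P0 (?e, 0)))\<^sup>2)"
    using projection_cinner(2)[OF assms, of "(?e, 0)"] by (simp add: P0_def norm_minus_commute)
  finally have m10: "- pf_matrix P [x] 1 0 = \<dots>" .
  show ?thesis
    by (simp only: pfaffian_1 diff_conv_add_uminus m01 m10) simp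
qed

lemma cinner_ell2_basis:
  "cinner (ell2_basis x) (ell2_basis y) = (if x = y then 1 else 0)"
proof transfer
  fix x y :: 'a
  have "(\<Sum>\<^sub>\<infinity>z. cnj (if x = z then 1 else 0) * (if y = z then 1 else 0)) =
      (\<Sum>\<^sub>\<infinity>z\<in>{x}. cnj (if x = z then 1 else 0) * (if y = z then 1 else (0::complex)))"
    by (rule infsum_cong_neutral) auto
  then show "(\<Sum>\<^sub>\<infinity>z. cnj (if x = z then 1 else 0) * (if y = z then 1 else 0)) =
      (if x = y then 1 else (0::complex))"
    by simp
qed

lemma summable_one_point:
  assumes "P \<in> Gr" "hilbert_schmidt (\<lambda>u. P u - P0 u)" "pfaffian_process P M"
  shows "(\<lambda>x. measure M {\<omega>. \<omega> x}) summable_on UNIV"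
proof -
  let ?A = "\<lambda>u. P u - P0 u"
  have P: "selfadjoint P" "P \<circ> P = P"
    using assms(1) by (auto simp: Gr_def Q_ops_def)
  have "selfadjoint ?A"
    using P(1)
    by (simp add: selfadjoint_def cinner_diff_left cinner_diff_right P0_def cinner_prod_def)
  note sm = selfadjoint_hilbert_schmidt_summable[OF assms(2) this]
  have "(\<lambda>x. (norm (?A (ell2_basis x, 0)))\<^sup>2) summable_on UNIV"
    by (rule sm) (simp add: orthonormal_on_def cinner_prod_def cinner_ell2_basis)
  moreover have "(\<lambda>x. (norm (?A (0, ell2_basis x)))\<^sup>2) summable_on UNIV"
    by (rule sm) (simp add: orthonormal_on_def cinner_prod_def cinner_ell2_basis)
  ultimately have "(\<lambda>x. ((norm (?A (ell2_basis x, 0)))\<^sup>2 + (norm (?A (0, ell2_basis x)))\<^sup>2) * (1/2))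
      summable_on UNIV"
    by (intro summable_on_cmult_left summable_on_add)
  moreover have "measure M {\<omega>. \<omega> x} =
      ((norm (?A (ell2_basis x, 0)))\<^sup>2 + (norm (?A (0, ell2_basis x)))\<^sup>2) * (1/2)" for x
  proof -
    have "{\<omega>. \<omega> x} = {\<omega>. \<forall>y\<in>set [x]. \<omega> y}"
      by simp
    then have "complex_of_real (measure M {\<omega>. \<omega> x}) = pfaffian (length [x]) (pf_matrix P [x])"
      using assms(3) distinct_singleton[of x] unfolding pfaffian_process_def by presburger
    then have "complex_of_real (measure M {\<omega>. \<omega> x}) = pfaffian 1 (pf_matrix P [x])"
      by simp
    then show ?thesis
      unfolding pfaffian_one_point[OF P] of_real_eq_iff by simp
  qed
  ultimately show ?thesis
    by (simp only:)
qed

section \<open>Finiteness from a summable one-point function\<close>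

lemma sets_occupied: "{\<omega> :: 'a::countable \<Rightarrow> bool. \<omega> x} \<in> sets borel"
proof -
  have "{True} = {False<..}"
    by (auto simp: less_bool_def)
  then have "open {True}"
    by (metis open_greaterThan)
  then have "open ((\<lambda>\<omega> :: 'a \<Rightarrow> bool. \<omega> x) -` {True})"
    by (intro open_vimage continuous_on_product_coordinates)
  then show ?thesis
    by (simp add: vimage_def)
qed

text \<open>Measurable because a countable set has only countably many finite subsets.\<close>

lemma sets_finite_configs: "(finite_configs :: ('a::countable \<Rightarrow> bool) set) \<in> sets borel"
proof (rule sets.countable)
  show "{\<omega>} \<in> sets borel" for \<omega> :: "'a \<Rightarrow> bool"
  proof -
    let ?C = "\<lambda>x. if \<omega> x then {\<omega>'. \<omega>' x} else - {\<omega>'. \<omega>' x}"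
    have "?C x \<in> sets borel" for x
      using sets_occupied[of x] by (simp add: borel_comp)
    then have "(\<Inter>x. ?C x) \<in> sets borel"
      by (intro sets.countable_INT' image_subsetI)
        (simp_all only: countableI_type UNIV_not_empty not_False_eq_True)
    also have "(\<Inter>x. ?C x) = {\<omega>}"
      by (auto simp: fun_eq_iff split: if_splits)
    finally show ?thesis .
  qed
  have eq: "(finite_configs :: ('a \<Rightarrow> bool) set) = (\<lambda>F x. x \<in> F) ` {F. finite F}"
    by (auto simp: finite_configs_def image_iff intro!: exI[of _ "{x. _ x}"])
  show "countable (finite_configs :: ('a \<Rightarrow> bool) set)"
    unfolding eq by (rule countable_image[OF countable_Collect_finite])
qed

text \<open>The Borel--Cantelli lemma is about sequences of events, so the points are enumerated by
  \<open>to_nat\<close>; an index \<open>n\<close> that belongs to no point gets the empty event.\<close>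

lemma AE_finite_config:
  fixes M :: "('a::countable \<Rightarrow> bool) measure"
  assumes "prob_space M" "sets M = sets borel" "(\<lambda>x. measure M {\<omega>. \<omega> x}) summable_on UNIV"
  shows "AE \<omega> in M. finite {x. \<omega> x}"
proof -
  interpret prob_space M by fact
  let ?E = "\<lambda>n. {\<omega> \<in> space M. \<exists>x. to_nat x = n \<and> \<omega> x}"
  have space: "space M = UNIV"
    using sets_eq_imp_space_eq[OF assms(2)] by simp
  have E: "?E (to_nat x) = {\<omega>. \<omega> x}" for x :: 'a
    by (auto simp: space)
  have E0: "?E n = {}" if "n \<notin> range (to_nat :: 'a \<Rightarrow> nat)" for n
    using that by auto
  have sets: "?E n \<in> sets M" for n
  proof (cases "n \<in> range (to_nat :: 'a \<Rightarrow> nat)")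
    case True
    then obtain x :: 'a where "n = to_nat x"
      by blast
    then show ?thesis
      using sets_occupied[of x] by (simp only: E assms(2))
  next
    case False
    then show ?thesis
      by (metis E0 sets.empty_sets)
  qed
  have "(\<lambda>n. measure M (?E n)) summable_on range (to_nat :: 'a \<Rightarrow> nat)"
    using assms(3) by (subst summable_on_reindex) (simp_all add: space o_def)
  then have "(\<lambda>n. measure M (?E n)) summable_on UNIV"
    by (subst summable_on_cong_neutral[where T = "range (to_nat :: 'a \<Rightarrow> nat)"])
      (auto simp: E0)
  then have "summable (\<lambda>n. measure M (?E n))"
    by (rule summable_on_imp_summable)
  then have "AE \<omega> in M. eventually (\<lambda>n. \<omega> \<in> space M - ?E n) sequentially"
    by (intro borel_cantelli_AE1 sets) (simp_all add: emeasure_eq_measure)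
  then show ?thesis
  proof (rule AE_mp[OF _ AE_I2], intro impI)
    fix \<omega> assume "eventually (\<lambda>n. \<omega> \<in> space M - ?E n) sequentially"
    then obtain k where "\<forall>n\<ge>k. \<omega> \<notin> ?E n"
      by (auto simp: eventually_sequentially)
    then have "to_nat ` {x. \<omega> x} \<subseteq> {..<k}"
      by (auto simp: space not_less[symmetric])
    then have "finite (to_nat ` {x. \<omega> x})"
      by (rule finite_subset) simp
    then show "finite {x. \<omega> x}"
      by (rule finite_imageD) simp
  qed
qed

theorem proposition1p8:
  fixes P :: "'a::countable doubled \<Rightarrow> 'a doubled" and M :: "('a \<Rightarrow> bool) measure"
  assumes "P \<in> Gr"
    and "hilbert_schmidt (\<lambda>u. P u - P0 u)"
    and "pfaffian_process P M"
  shows "measure M finite_configs = 1 \<and>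
    (\<forall>(N :: 'b measure) X. obeys N X M \<longrightarrow> (AE w in N. finite {x. X w x}))"
proof -
  have M: "prob_space M" "sets M = sets borel"
    using assms(3) by (auto simp: pfaffian_process_def)
  have ae: "AE \<omega> in M. finite {x. \<omega> x}"
    using M summable_one_point[OF assms] by (rule AE_finite_config)
  have "measure M finite_configs = 1"
    using ae sets_finite_configs M
    by (subst prob_space.prob_eq_1) (simp_all add: finite_configs_def)
  moreover have "AE w in N. finite {x. X w x}" if "obeys N X M" for N :: "'b measure" and X
    using that ae AE_distrD[of X N borel "\<lambda>\<omega>. finite {x. \<omega> x}"] by (auto simp: obeys_def)
  ultimately show ?thesis
    by blast
qed

end
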